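(* There is a function $\varepsilon:\mathbb{N}\to\mathbb{R}$ with $\varepsilon(n)\to 0$ as $n\to\infty$ such that for every positive integer $n$ and every subset $A\subset\mathbb{Z}_{n}^{*}\subset\mathbb{Z}_{n}$ with $\Sigma(A)\neq\mathbb{Z}_{n}$, $$|A|\le (2+\varepsilon(n))\sqrt{n}.$$
   Context: $\mathbb{Z}_n$ is the additive group of integers modulo $n$, and $\mathbb{Z}_n^{*}\subset\mathbb{Z}_n$ is the set of elements coprime to $n$. For $A\subset\mathbb{Z}_n$, $\Sigma(A)=\{\sum_{a\in B}a:\,B\subset A\}$ is the set of all subset sums of $A$ (sums taken in the additive group $\mathbb{Z}_n$, the empty sum being $0$). *)

theory Defs
  imports Complex_Main "HOL-Algebra.Algebra"
begin

text \<open>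
  The additive group of integers modulo \<open>n\<close> is the library's \<^const>\<open>integer_mod_group\<close>, with
  carrier \<open>{0..<n}\<close> for \<open>n > 0\<close>. It is written multiplicatively: \<^const>\<open>monoid.mult\<close> is addition
  modulo \<open>n\<close>, and \<^const>\<open>finprod\<close> is the finite sum.
\<close>

definition coprime_residues :: "nat \<Rightarrow> int set" where
  "coprime_residues n = {a \<in> carrier (integer_mod_group n). coprime a (int n)}"

text \<open>
  The value of \<^const>\<open>finprod\<close> is meaningful only for finite subsets of the carrier, which is
  automatic for subsets of the carrier of a finite group.
\<close>

definition subset_sums :: "('a, 'b) monoid_scheme \<Rightarrow> 'a set \<Rightarrow> 'a set" where
  "subset_sums G A = {finprod G (\<lambda>a. a) B | B. B \<subseteq> A}"

lemma finprod_integer_mod_group: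
  assumes "n > 0" "B \<subseteq> carrier (integer_mod_group n)"
  shows "finprod (integer_mod_group n) (\<lambda>a. a) B = \<Sum>B mod int n"
proof -
  interpret comm_group "integer_mod_group n"
    by (rule abelian_integer_mod_group)
  have "finite B"
    using assms by (auto simp: carrier_integer_mod_group intro: finite_subset)
  then show ?thesis
    using assms(2)
  proof (induction B)
    case empty
    then show ?case by simp
  next
    case (insert x B)
    then have "finprod (integer_mod_group n) (\<lambda>a. a) (insert x B) =
        x \<otimes>\<^bsub>integer_mod_group n\<^esub> finprod (integer_mod_group n) (\<lambda>a. a) B"
      by (intro finprod_insert) auto
    with insert show ?case
      by (simp add: mod_add_right_eq)
  qed
qed

lemma subset_sums_integer_mod_group:
  assumes "n > 0" "A \<subseteq> carrier (integer_mod_group n)"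
  shows "subset_sums (integer_mod_group n) A = {\<Sum>B mod int n | B. B \<subseteq> A}"
  unfolding subset_sums_def using assms finprod_integer_mod_group
  by (metis (no_types, lifting) subset_trans)

end

(* Olson's method. In a finite abelian group of order n, let D be a set of u elements, each
   generating the group, and let gain B x = |xB - B| (writing the group multiplicatively). By
   Chowla's theorem the product set ({1} Un D)^j has at least min(n, ju + 1) elements; since gain B
   is subadditive, it is at most jM there, where M is its maximum on D. On the other hand the gains
   over any set Q sum to at least |Q||B| - |B|^2. Taking |Q| close to 2|B| <= n gives M >= u/2 up to
   a factor tending to 1 as |B|/u grows; larger B are handled by complementation. Multiplying a large
   set greedily by {1, x} for x in D therefore adds about u^2/4 elements. If the subset products of
   A miss an element of the group, set aside two small parts of A: one supplies the large starting
   set, the other keeps all intermediate sets away from the whole group by pigeonhole. This leaves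
   |A|^2/4 <= n up to lower order terms. *)

theory Submission
  imports Defs "HOL-Number_Theory.Cong" "HOL-Real_Asymp.Real_Asymp"
begin

locale finite_comm_group = comm_group +
  assumes finite_carrier [simp]: "finite (carrier G)"
begin

section \<open>Generators of a finite abelian group and Chowla's theorem\<close>

definition gens :: "'a set" where
  "gens = {x \<in> carrier G. generate G {x} = carrier G}"

lemma gens_subset: "gens \<subseteq> carrier G"
  by (auto simp: gens_def)

lemma finite_sub [simp]: "A \<subseteq> carrier G \<Longrightarrow> finite A"
  using finite_subset finite_carrier by blast

text \<open>Stability under \<open>x\<close> gives stability under all natural powers of
  \<open>x\<close>. In a finite group these already form the subgroup generated by \<open>x\<close>,
  so \<open>Y\<close> contains the full orbit of any of its elements.\<close>

lemma gens_closed_imp_carrier: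
  assumes "x \<in> gens" "Y \<subseteq> carrier G" "Y \<noteq> {}" "x <# Y \<subseteq> Y"
  shows "Y = carrier G"
proof
  have x: "x \<in> carrier G" "generate G {x} = carrier G"
    using assms(1) by (auto simp: gens_def)
  obtain y where y: "y \<in> Y" using assms(3) by blast
  have yc: "y \<in> carrier G" using y assms(2) by blast
  have pow: "x [^] k \<otimes> y \<in> Y" for k :: nat
  proof (induction k)
    case 0
    then show ?case using y yc by simp
  next
    case (Suc k)
    have "x [^] Suc k \<otimes> y = x \<otimes> (x [^] k \<otimes> y)"
      by (simp only: nat_pow_Suc2[OF x(1)] m_assoc[OF x(1) nat_pow_closed[OF x(1)] yc])
    moreover have "x \<otimes> (x [^] k \<otimes> y) \<in> x <# Y"
      using Suc by (auto simp: l_coset_def)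
    ultimately show ?case using assms(4) by auto
  qed
  show "carrier G \<subseteq> Y"
  proof
    fix g assume g: "g \<in> carrier G"
    then have "g \<otimes> inv y \<in> generate G {x}" using x yc by simp
    then obtain k :: nat where "g \<otimes> inv y = x [^] k"
      using generate_pow_on_finite_carrier[OF finite_carrier x(1)] by auto
    then have "g = x [^] k \<otimes> y"
      using g yc x by (metis inv_solve_right nat_pow_closed)
    then show "g \<in> Y" using pow by simp
  qed
qed (use assms in auto)

lemma card_l_coset:
  assumes "x \<in> carrier G" "B \<subseteq> carrier G"
  shows "card (x <# B) = card B"
proof -
  have "(x <# B) = (\<lambda>b. x \<otimes> b) ` B" by (auto simp: l_coset_def)
  moreover have "inj_on (\<lambda>b. x \<otimes> b) B"
    using assms by (intro inj_onI) (metis l_cancel subsetD)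
  ultimately show ?thesis by (simp add: card_image)
qed

lemma set_mult_mem: "a \<in> A \<Longrightarrow> b \<in> B \<Longrightarrow> a \<otimes> b \<in> A <#> B"
  by (auto simp: set_mult_def)

text \<open>Chowla's theorem; the induction step moves elements from \<open>B\<close> to \<open>A\<close> (Davenport's transform).\<close>

lemma card_set_mult_ge:
  assumes "A \<subseteq> carrier G" "A \<noteq> {}" "\<one> \<in> B" "B - {\<one>} \<subseteq> gens"
  shows "min (order G) (card A + card B - 1) \<le> card (A <#> B)"
  using assms
proof (induction "card B" arbitrary: A B rule: less_induct)
  case less
  have Bc: "B \<subseteq> carrier G" using less.prems gens_subset by auto
  have finB: "finite B" and finA: "finite A" using Bc less.prems by auto
  have ABc: "A <#> B \<subseteq> carrier G" using set_mult_closed less.prems Bc by blast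
  have AsubAB: "A \<subseteq> A <#> B"
  proof
    fix a assume "a \<in> A"
    then show "a \<in> A <#> B" using set_mult_mem[of a A \<one> B] less.prems by auto
  qed
  show ?case
  proof (cases "A <#> B \<subseteq> A")
    case True
    show ?thesis
    proof (cases "B = {\<one>}")
      case True
      then show ?thesis using card_mono[OF finite_sub[OF ABc] AsubAB] by simp
    next
      case False
      then obtain b where b: "b \<in> B" "b \<noteq> \<one>" using less.prems by auto
      have "b <# A \<subseteq> A"
      proof
        fix z assume "z \<in> b <# A"
        then obtain a where "a \<in> A" "z = b \<otimes> a" by (auto simp: l_coset_def)
        then have "z = a \<otimes> b" using b(1) Bc less.prems(1) m_comm[of b a] by (metis subsetD)
        then have "z \<in> A <#> B" using set_mult_mem[OF \<open>a \<in> A\<close> b(1)] by simp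
        then show "z \<in> A" using True by (rule rev_subsetD)
      qed
      then have "A = carrier G"
        using gens_closed_imp_carrier[of b A] b less.prems by auto
      then have "A <#> B = carrier G" using AsubAB ABc by auto
      then show ?thesis by (simp add: order_def)
    qed
  next
    case False
    then obtain a b0 where ab0: "a \<in> A" "b0 \<in> B" "a \<otimes> b0 \<notin> A"
      by (auto simp: set_mult_def)
    have ac: "a \<in> carrier G" using ab0 less.prems by auto
    \<comment> \<open>Each \<open>b\<close> with \<open>a \<otimes> b\<close> outside
      \<open>A\<close> leaves \<open>B\<close>, and \<open>a \<otimes> b\<close> joins
      \<open>A\<close> instead. The sum of the cardinalities is kept, \<open>b0\<close> is certain
      to leave, and \<open>\<one>\<close> stays because \<open>a\<close> lies in
      \<open>A\<close>.\<close>
    define B' where "B' = {b \<in> B. a \<otimes> b \<in> A}"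
    define A' where "A' = A \<union> (a <# (B - B'))"
    have disj: "A \<inter> (a <# (B - B')) = {}"
      by (auto simp: B'_def l_coset_def)
    have sub: "a <# (B - B') \<subseteq> carrier G"
      using ac Bc by (auto simp: l_coset_def)
    have B'B: "B' \<subset> B" using ab0 by (auto simp: B'_def)
    have card: "card A' + card B' = card A + card B"
    proof -
      have "card A' = card A + card (B - B')"
        unfolding A'_def using card_Un_disjoint[OF finA finite_sub[OF sub] disj]
          card_l_coset[of a "B - B'"] ac Bc by auto
      moreover have "card (B - B') + card B' = card B"
        using B'B finB card_Diff_subset[of B' B] card_mono[of B B'] finite_subset[of B' B] by auto
      ultimately show ?thesis by simp
    qed
    have sub': "A' <#> B' \<subseteq> A <#> B"
    proof
      fix z assume "z \<in> A' <#> B'"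
      then obtain c b' where c: "c \<in> A'" "b' \<in> B'" "z = c \<otimes> b'" by (auto simp: set_mult_def)
      show "z \<in> A <#> B"
      proof (cases "c \<in> A")
        case True
        then show ?thesis using c by (auto simp: set_mult_def B'_def)
      next
        case False
        then obtain b where b: "b \<in> B" "c = a \<otimes> b" using c by (auto simp: A'_def l_coset_def)
        \<comment> \<open>Since \<open>b'\<close> survived in \<open>B'\<close>, the product
          \<open>a \<otimes> b'\<close> is in \<open>A\<close>; commutativity lets \<open>b\<close>
          take over the role of the factor from \<open>B\<close>.\<close>
        have "b \<in> carrier G" "b' \<in> carrier G" using b c Bc B'B by auto
        then have "z = (a \<otimes> b') \<otimes> b"
          using b(2) c(3) ac by (simp add: m_ac)
        then show ?thesis using b c by (auto simp: set_mult_def B'_def)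
      qed
    qed
    have "min (order G) (card A' + card B' - 1) \<le> card (A' <#> B')"
    proof (rule less.hyps)
      show "card B' < card B" using B'B finB psubset_card_mono by blast
      show "A' \<subseteq> carrier G" using less.prems sub by (auto simp: A'_def)
      show "A' \<noteq> {}" using ab0 by (auto simp: A'_def)
      show "\<one> \<in> B'" using less.prems ab0 ac by (auto simp: B'_def)
      show "B' - {\<one>} \<subseteq> gens" using B'B less.prems by auto
    qed
    also have "\<dots> \<le> card (A <#> B)" using sub' ABc by (intro card_mono) auto
    finally show ?thesis using card by simp
  qed
qed

section \<open>Gains of a set under translation\<close>

definition gain :: "'a set \<Rightarrow> 'a \<Rightarrow> nat" where
  "gain B x = card ((x <# B) - B)"

lemma l_coset_closed: "x \<in> carrier G \<Longrightarrow> B \<subseteq> carrier G \<Longrightarrow> x <# B \<subseteq> carrier G"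
  by (auto simp: l_coset_def)

lemma gain_one: "B \<subseteq> carrier G \<Longrightarrow> gain B \<one> = 0"
  by (auto simp: gain_def l_coset_def)

text \<open>Follow \<open>b\<close> through \<open>y\<close> and then \<open>x\<close>: if
  \<open>y \<otimes> b\<close> is in \<open>B\<close>, a final exit is counted by
  \<open>gain B x\<close>; otherwise the element lies in the \<open>x\<close>-translate of the part
  of \<open>y <# B\<close> outside \<open>B\<close>.\<close>

lemma gain_mult:
  assumes "x \<in> carrier G" "y \<in> carrier G" "B \<subseteq> carrier G"
  shows "gain B (x \<otimes> y) \<le> gain B x + gain B y"
proof -
  have "((x \<otimes> y) <# B) - B \<subseteq> (x <# ((y <# B) - B)) \<union> ((x <# B) - B)"
  proof
    fix z assume z: "z \<in> ((x \<otimes> y) <# B) - B"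
    then obtain b where b: "b \<in> B" "z = x \<otimes> (y \<otimes> b)"
      using assms by (auto simp: l_coset_def m_assoc subset_iff)
    show "z \<in> (x <# ((y <# B) - B)) \<union> ((x <# B) - B)"
      using b z by (cases "y \<otimes> b \<in> B") (auto simp: l_coset_def)
  qed
  moreover have "(x <# ((y <# B) - B)) \<union> ((x <# B) - B) \<subseteq> carrier G"
    using assms by (auto simp: l_coset_def)
  ultimately have "gain B (x \<otimes> y) \<le> card ((x <# ((y <# B) - B)) \<union> ((x <# B) - B))"
    unfolding gain_def by (intro card_mono finite_sub)
  also have "\<dots> \<le> card (x <# ((y <# B) - B)) + gain B x"
    unfolding gain_def by (rule card_Un_le)
  also have "card (x <# ((y <# B) - B)) = gain B y"
    unfolding gain_def using assms l_coset_closed[of y B] by (intro card_l_coset) auto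
  finally show ?thesis by simp
qed

lemma gain_plus_card_Int:
  assumes "x \<in> carrier G" "B \<subseteq> carrier G"
  shows "gain B x + card ((x <# B) \<inter> B) = card B"
proof -
  have "finite (x <# B)" using l_coset_closed[OF assms] by simp
  then have "card (x <# B) = card ((x <# B) - B) + card ((x <# B) \<inter> B)"
    by (metis add.commute card_Int_Diff)
  then show ?thesis using assms by (simp add: gain_def card_l_coset)
qed

text \<open>Translation commutes with complement, so the left side counts
  \<open>B - (x <# B)\<close>, and \<open>B\<close> and \<open>x <# B\<close> have equal
  cardinality.\<close>

lemma gain_compl:
  assumes "x \<in> carrier G" "B \<subseteq> carrier G"
  shows "gain (carrier G - B) x = gain B x"
proof -
  have fin: "finite B" "finite (x <# B)" using assms l_coset_closed by auto
  have "(x <# (carrier G - B)) = carrier G - (x <# B)"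
  proof
    show "x <# (carrier G - B) \<subseteq> carrier G - (x <# B)"
      using assms by (auto simp: l_coset_def)
    show "carrier G - (x <# B) \<subseteq> x <# (carrier G - B)"
    proof
      fix z assume z: "z \<in> carrier G - (x <# B)"
      then have e: "z = x \<otimes> (inv x \<otimes> z)" using assms by (simp add: m_assoc[symmetric])
      then have "inv x \<otimes> z \<notin> B" using z by (auto simp: l_coset_def)
      then show "z \<in> x <# (carrier G - B)"
        unfolding l_coset_def using e z assms by blast
    qed
  qed
  then have "gain (carrier G - B) x = card (B - (x <# B))"
    unfolding gain_def using assms by (intro arg_cong[where f = card]) auto
  moreover have "card (B - (x <# B)) + card ((x <# B) \<inter> B) = card B"
    using fin by (metis Int_commute add.commute card_Int_Diff)
  ultimately show ?thesis using gain_plus_card_Int[OF assms] by simp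
qed

text \<open>Double counting: a pair of \<open>x\<close> in \<open>Q\<close> and \<open>c\<close> in
  \<open>(x <# B) \<inter> B\<close> is determined by \<open>(inv x \<otimes> c, c)\<close> in
  \<open>B \<times> B\<close>, so these intersections have total size at most
  \<open>card B * card B\<close>.\<close>

lemma sum_gain_ge:
  assumes "Q \<subseteq> carrier G" "B \<subseteq> carrier G"
  shows "card Q * card B \<le> (\<Sum>x\<in>Q. gain B x) + card B * card B"
proof -
  have fin: "finite Q" "finite B" using assms by auto
  let ?S = "SIGMA x:Q. (x <# B) \<inter> B"
  have "(\<Sum>x\<in>Q. card ((x <# B) \<inter> B)) = card ?S"
    using fin by (simp add: card_SigmaI)
  also have "\<dots> \<le> card (B \<times> B)"
  proof (rule card_inj_on_le)
    show "inj_on (\<lambda>(x, c). (inv x \<otimes> c, c)) ?S"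
      using assms by (auto simp: inj_on_def l_coset_def subset_iff)
    show "(\<lambda>(x, c). (inv x \<otimes> c, c)) ` ?S \<subseteq> B \<times> B"
    proof
      fix z assume "z \<in> (\<lambda>(x, c). (inv x \<otimes> c, c)) ` ?S"
      then obtain x b where x: "x \<in> Q" "b \<in> B" "x \<otimes> b \<in> B" "z = (inv x \<otimes> (x \<otimes> b), x \<otimes> b)"
        by (auto simp: l_coset_def)
      then have "inv x \<otimes> (x \<otimes> b) = b" using assms by (auto simp: m_assoc[symmetric] subset_iff)
      then show "z \<in> B \<times> B" using x by simp
    qed
  qed (use fin in auto)
  finally have "(\<Sum>x\<in>Q. card ((x <# B) \<inter> B)) \<le> card B * card B"
    by (simp add: card_cartesian_product)
  moreover have "(\<Sum>x\<in>Q. gain B x + card ((x <# B) \<inter> B)) = (\<Sum>x\<in>Q. card B)"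
    using assms by (intro sum.cong) (auto simp: gain_plus_card_Int)
  ultimately show ?thesis by (simp add: sum.distrib)
qed

section \<open>Iterated product sets and elements of large gain\<close>

primrec iter_mult :: "'a set \<Rightarrow> nat \<Rightarrow> 'a set" where
  "iter_mult T 0 = {\<one>}"
| "iter_mult T (Suc j) = iter_mult T j <#> T"

lemma iter_mult_closed: "T \<subseteq> carrier G \<Longrightarrow> iter_mult T j \<subseteq> carrier G"
  by (induction j) (simp_all add: set_mult_closed)

lemma one_in_iter_mult: "\<one> \<in> T \<Longrightarrow> \<one> \<in> iter_mult T j"
proof (induction j)
  case (Suc j)
  then show ?case using set_mult_mem[of \<one> "iter_mult T j" \<one> T] by simp
qed simp

lemma iter_mult_mono:
  assumes "\<one> \<in> T" "T \<subseteq> carrier G"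
  shows "iter_mult T j \<subseteq> iter_mult T (Suc j)"
proof
  fix x assume x: "x \<in> iter_mult T j"
  then have "x \<in> carrier G" using iter_mult_closed[OF assms(2)] by auto
  then show "x \<in> iter_mult T (Suc j)"
    using set_mult_mem[OF x assms(1)] by simp
qed

text \<open>Chowla's theorem applied to one factor at a time: each contributes \<open>card D\<close>
  further elements until the group is exhausted.\<close>

lemma card_iter_mult_ge:
  assumes "D \<subseteq> gens" "\<one> \<notin> D"
  shows "min (order G) (j * card D + 1) \<le> card (iter_mult (insert \<one> D) j)"
proof (induction j)
  case 0
  then show ?case by simp
next
  case (Suc j)
  let ?T = "insert \<one> D"
  have T: "?T \<subseteq> carrier G" using assms gens_subset by auto
  have fin: "finite D" using T by auto
  have "min (order G) (card (iter_mult ?T j) + card ?T - 1) \<le> card (iter_mult ?T j <#> ?T)"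
  proof (rule card_set_mult_ge[OF iter_mult_closed[OF T]])
    show "iter_mult ?T j \<noteq> {}" using one_in_iter_mult[of ?T j] by auto
  qed (use assms in auto)
  moreover have "card ?T = card D + 1" using fin assms(2) by simp
  moreover have "Suc j * card D = j * card D + card D" by simp
  ultimately show ?case using Suc unfolding iter_mult.simps by linarith
qed

lemma gain_iter_mult_le:
  assumes "T \<subseteq> carrier G" "B \<subseteq> carrier G" "\<And>x. x \<in> T \<Longrightarrow> gain B x \<le> M"
    "x \<in> iter_mult T j"
  shows "gain B x \<le> j * M"
  using assms(4)
proof (induction j arbitrary: x)
  case 0
  then show ?case using gain_one[OF assms(2)] by simp
next
  case (Suc j)
  then obtain y t where yt: "y \<in> iter_mult T j" "t \<in> T" "x = y \<otimes> t"
    by (auto simp: set_mult_def)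
  have "gain B x \<le> gain B y + gain B t"
    using yt assms iter_mult_closed[OF assms(1)] gain_mult by blast
  then show ?case using Suc.IH[OF yt(1)] assms(3)[OF yt(2)] by simp
qed

text \<open>\<open>Q\<close> is built in layers: the i-th consists of \<open>card D\<close> new
  elements of the i-fold product set, each of gain at most \<open>i * M\<close> by subadditivity.
  Summing over i gives the triangular number j (j + 1) / 2. Chowla's bound leaves room for every
  layer.\<close>

lemma low_gain_set:
  assumes "D \<subseteq> gens" "\<one> \<notin> D" "B \<subseteq> carrier G" "\<And>x. x \<in> D \<Longrightarrow> gain B x \<le> M"
    "j * card D \<le> order G"
  shows "\<exists>Q \<subseteq> iter_mult (insert \<one> D) j. card Q = j * card D \<and>
    2 * (\<Sum>x\<in>Q. gain B x) \<le> M * card D * (j * (j + 1))"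
  using assms(5)
proof (induction j)
  case 0
  show ?case by (intro exI[of _ "{}"]) auto
next
  case (Suc j)
  let ?T = "insert \<one> D"
  have T: "?T \<subseteq> carrier G" using assms gens_subset by auto
  obtain Q where Q: "Q \<subseteq> iter_mult ?T j" "card Q = j * card D"
      "2 * (\<Sum>x\<in>Q. gain B x) \<le> M * card D * (j * (j + 1))"
    using Suc by auto
  let ?P = "iter_mult ?T (Suc j)"
  have Pc: "?P \<subseteq> carrier G" using iter_mult_closed[OF T] .
  have QP: "Q \<subseteq> ?P" using Q(1) iter_mult_mono[OF _ T, of j] by auto
  have "Suc j * card D \<le> card ?P"
    using card_iter_mult_ge[OF assms(1,2), of "Suc j"] Suc.prems by (simp split: if_splits add: min_def)
  then have "card D \<le> card (?P - Q)"
    using Q(2) QP Pc by (subst card_Diff_subset) auto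
  then obtain R where R: "R \<subseteq> ?P - Q" "card R = card D" "finite R"
    using obtain_subset_with_card_n by metis
  have finQ: "finite Q" using QP Pc by auto
  have "gain B y \<le> M" if "y \<in> ?T" for y
    using that assms(4) gain_one[OF assms(3)] by auto
  then have "gain B x \<le> Suc j * M" if "x \<in> ?P" for x
    using gain_iter_mult_le[OF T assms(3)] that by blast
  then have "(\<Sum>x\<in>R. gain B x) \<le> of_nat (card R) * (Suc j * M)"
    using R by (intro sum_bounded_above) auto
  moreover have "(\<Sum>x\<in>Q \<union> R. gain B x) = (\<Sum>x\<in>Q. gain B x) + (\<Sum>x\<in>R. gain B x)"
    using R finQ by (intro sum.union_disjoint) auto
  ultimately have "2 * (\<Sum>x\<in>Q \<union> R. gain B x) \<le> M * card D * (j * (j + 1)) + 2 * (card D * (Suc j * M))"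
    using Q(3) R(2) by simp
  also have "\<dots> = M * card D * (Suc j * (Suc j + 1))"
    by (simp add: algebra_simps)
  finally have "2 * (\<Sum>x\<in>Q \<union> R. gain B x) \<le> M * card D * (Suc j * (Suc j + 1))" .
  moreover have "card (Q \<union> R) = Suc j * card D"
    using R finQ Q(2) by (subst card_Un_disjoint) auto
  moreover have "Q \<union> R \<subseteq> ?P" using QP R(1) by blast
  ultimately show ?case by (intro exI[of _ "Q \<union> R"] conjI)
qed

text \<open>Comparing the two estimates for the gains over a set of \<open>J * card D\<close>
  elements, with \<open>J\<close> the integer part of \<open>2 * card B / card D\<close>, bounds the
  maximal gain below by \<open>card D * (J - 1) / (2 * J)\<close>. \<open>K\<close> is a precision
  parameter: \<open>K + 1 \<le> J\<close> turns the loss into the factor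
  \<open>K / (K + 1)\<close>.\<close>

lemma exists_large_gain_half:
  assumes "D \<subseteq> gens" "\<one> \<notin> D" "D \<noteq> {}" "B \<subseteq> carrier G"
    "(K + 1) * card D \<le> 2 * card B" "2 * card B \<le> order G"
  shows "\<exists>x\<in>D. K * card D \<le> 2 * (K + 1) * gain B x"
proof -
  have finD: "finite D" using assms gens_subset by auto
  define u where "u = card D"
  define b where "b = card B"
  have u: "u > 0" using finD assms by (auto simp: u_def card_gt_0_iff)
  define M where "M = Max (gain B ` D)"
  have M: "gain B x \<le> M" if "x \<in> D" for x using that finD by (simp add: M_def)
  obtain x where x: "x \<in> D" "gain B x = M"
    using Max_in[of "gain B ` D"] finD assms(3) unfolding M_def by (metis empty_is_image finite_imageI imageE)
  \<comment> \<open>To leading order the estimates give a maximum of at least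
    \<open>2 * b * u * (|Q| - b) / |Q|^2\<close>, which is largest for \<open>|Q| = 2 * b\<close>;
    \<open>J\<close> counts the full layers of size \<open>u\<close> that fit.\<close>
  define J where "J = (2 * b) div u"
  define r where "r = (2 * b) mod u"
  have Jr: "2 * b = u * J + r" "r < u" using u by (auto simp: J_def r_def)
  have J: "K + 1 \<le> J" unfolding J_def using assms(5) u by (simp add: u_def b_def less_eq_div_iff_mult_less_eq)
  have "J * u \<le> order G" using Jr assms(6) by (simp add: b_def mult.commute)
  then obtain Q where Q: "Q \<subseteq> iter_mult (insert \<one> D) J" "card Q = J * u"
      "2 * (\<Sum>x\<in>Q. gain B x) \<le> M * u * (J * (J + 1))"
    using low_gain_set[OF assms(1,2,4) M, of J] by (auto simp: u_def)
  have "Q \<subseteq> carrier G"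
    using Q(1) iter_mult_closed[of "insert \<one> D" J] assms gens_subset by auto
  then have "J * u * b \<le> (\<Sum>x\<in>Q. gain B x) + b * b"
    using sum_gain_ge[of Q B] assms(4) Q(2) by (simp add: b_def)
  then have "2 * (J * u) * (2 * b) \<le> 2 * (M * u * (J * (J + 1))) + (2 * b) * (2 * b)"
    using Q(3) by simp
  then have "int (2 * (J * u) * (2 * b)) \<le> int (2 * (M * u * (J * (J + 1))) + (2 * b) * (2 * b))"
    by (rule of_nat_mono)
  then have "2 * (int J * int u) * (int u * int J + int r) \<le>
      2 * (int M * int u * (int J * (int J + 1))) + (int u * int J + int r) * (int u * int J + int r)"
    unfolding Jr by (simp add: algebra_simps)
  \<comment> \<open>The left side less the final square is \<open>(u * J + r) * (u * J - r)\<close>,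
    so rounding costs only \<open>r * r\<close>. Bounding this by \<open>u * u\<close> leaves
    \<open>u * u * (J * J - 1)\<close>, from which the common factor \<open>u * (J + 1)\<close>
    cancels.\<close>
  then have "int u * int u * (int J * int J) - int r * int r \<le> 2 * (int M * int u * (int J * (int J + 1)))"
    by (simp add: algebra_simps)
  moreover have "int r * int r \<le> int u * int u" using Jr by (intro mult_mono) auto
  ultimately have "int u * int u * (int J * int J) - int u * int u \<le> 2 * (int M * int u * (int J * (int J + 1)))"
    by linarith
  then have "(int u * (int J + 1)) * (int u * (int J - 1)) \<le> (int u * (int J + 1)) * (2 * int M * int J)"
    by (simp add: algebra_simps)
  then have uJ: "int u * (int J - 1) \<le> 2 * int M * int J"
    using u by (subst (asm) mult_le_cancel_left_pos) auto
  have "int J * (int K * int u) \<le> (int K + 1) * (int u * (int J - 1))"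
  proof -
    have "(int K + 1) * (int u * (int J - 1)) - int J * (int K * int u) = int u * (int J - (int K + 1))"
      by (simp add: algebra_simps)
    also have "\<dots> \<ge> 0" using J by (intro mult_nonneg_nonneg) auto
    finally show ?thesis by simp
  qed
  also have "\<dots> \<le> (int K + 1) * (2 * int M * int J)" using uJ by (intro mult_left_mono) auto
  finally have "int J * (int K * int u) \<le> int J * (2 * (int K + 1) * int M)"
    by (simp add: algebra_simps)
  then have "int K * int u \<le> 2 * (int K + 1) * int M"
    using J by (subst (asm) mult_le_cancel_left_pos) auto
  then have "int (K * u) \<le> int (2 * (K + 1) * M)" by (simp add: algebra_simps)
  then have "K * u \<le> 2 * (K + 1) * M" by (simp only: of_nat_le_iff)
  then show ?thesis using x u_def by blast
qed

text \<open>The last hypothesis is the lower size bound for the complement of \<open>B\<close>,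
  which has the same gains; the smaller of the two sets is used.\<close>

lemma exists_large_gain:
  assumes "D \<subseteq> gens" "\<one> \<notin> D" "D \<noteq> {}" "B \<subseteq> carrier G"
    "(K + 1) * card D \<le> 2 * card B" "(K + 1) * card D + 2 * card B \<le> 2 * order G"
  shows "\<exists>x\<in>D. K * card D \<le> 2 * (K + 1) * gain B x"
proof (cases "2 * card B \<le> order G")
  case True
  then show ?thesis using exists_large_gain_half assms by blast
next
  case False
  have "card (carrier G - B) = order G - card B"
    using assms(4) by (simp add: card_Diff_subset order_def)
  then have "\<exists>x\<in>D. K * card D \<le> 2 * (K + 1) * gain (carrier G - B) x"
    using assms False by (intro exists_large_gain_half) auto
  then show ?thesis using gain_compl assms gens_subset by (metis subsetD)
qed

section \<open>Subset sums as product sets\<close>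

lemma subset_sums_closed: "A \<subseteq> carrier G \<Longrightarrow> subset_sums G A \<subseteq> carrier G"
  unfolding subset_sums_def by (auto intro!: finprod_closed)

lemma subset_sumsI: "S \<subseteq> A \<Longrightarrow> finprod G (\<lambda>a. a) S \<in> subset_sums G A"
  by (auto simp: subset_sums_def)

lemma subset_subset_sums:
  assumes "A \<subseteq> carrier G"
  shows "A \<subseteq> subset_sums G A"
proof
  fix x assume x: "x \<in> A"
  then have "x = finprod G (\<lambda>a. a) {x}" using assms by auto
  then show "x \<in> subset_sums G A" using subset_sumsI[of "{x}" A] x by simp
qed

lemma subset_sums_empty [simp]: "subset_sums G {} = {\<one>}"
  by (simp add: subset_sums_def)

lemma subset_sums_mono: "A \<subseteq> B \<Longrightarrow> subset_sums G A \<subseteq> subset_sums G B"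
  by (auto simp: subset_sums_def)

lemma one_in_subset_sums: "\<one> \<in> subset_sums G A"
  using subset_sumsI[of "{}" A] by simp

lemma subset_sums_singleton:
  assumes "x \<in> carrier G"
  shows "subset_sums G {x} = {\<one>, x}"
proof -
  have "{B. B \<subseteq> {x}} = {{}, {x}}" by auto
  then have "subset_sums G {x} = finprod G (\<lambda>a. a) ` {{}, {x}}"
    unfolding subset_sums_def by (metis setcompr_eq_image)
  then show ?thesis using assms by simp
qed

lemma subset_sums_Un:
  assumes "A \<subseteq> carrier G" "B \<subseteq> carrier G" "A \<inter> B = {}"
  shows "subset_sums G (A \<union> B) = subset_sums G A <#> subset_sums G B"
proof
  have eq: "finprod G (\<lambda>a. a) (S \<union> T) = finprod G (\<lambda>a. a) S \<otimes> finprod G (\<lambda>a. a) T"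
    if "S \<subseteq> A" "T \<subseteq> B" for S T
    using that assms by (intro finprod_Un_disjoint finite_sub) auto
  show "subset_sums G (A \<union> B) \<subseteq> subset_sums G A <#> subset_sums G B"
  proof
    fix z assume "z \<in> subset_sums G (A \<union> B)"
    then obtain S where S: "S \<subseteq> A \<union> B" "z = finprod G (\<lambda>a. a) S"
      by (auto simp: subset_sums_def)
    have "(S \<inter> A) \<union> (S \<inter> B) = S" using S by auto
    then have "z = finprod G (\<lambda>a. a) (S \<inter> A) \<otimes> finprod G (\<lambda>a. a) (S \<inter> B)"
      using eq[of "S \<inter> A" "S \<inter> B"] S(2) by (metis Int_lower2)
    then show "z \<in> subset_sums G A <#> subset_sums G B"
      using set_mult_mem[OF subset_sumsI[of "S \<inter> A" A] subset_sumsI[of "S \<inter> B" B]] by simp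
  qed
  show "subset_sums G A <#> subset_sums G B \<subseteq> subset_sums G (A \<union> B)"
  proof
    fix z assume "z \<in> subset_sums G A <#> subset_sums G B"
    then obtain S T where "S \<subseteq> A" "T \<subseteq> B" "z = finprod G (\<lambda>a. a) S \<otimes> finprod G (\<lambda>a. a) T"
      by (auto simp: set_mult_def subset_sums_def)
    then show "z \<in> subset_sums G (A \<union> B)"
      using eq[of S T] subset_sumsI[of "S \<union> T" "A \<union> B"] by auto
  qed
qed

text \<open>The link between gains and subset sums: a further summand \<open>x\<close> contributes
  the factor \<open>{\<one>, x}\<close>.\<close>

lemma card_set_mult_pair:
  assumes "x \<in> carrier G" "B \<subseteq> carrier G"
  shows "card (B <#> {\<one>, x}) = card B + gain B x"
proof -
  have "B <#> {\<one>, x} = (\<Union>b\<in>B. {b \<otimes> \<one>, b \<otimes> x})"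
    by (auto simp: set_mult_def)
  also have "\<dots> = (\<Union>b\<in>B. {b, x \<otimes> b})"
  proof (intro SUP_cong refl)
    fix b assume "b \<in> B"
    then have "b \<in> carrier G" using assms by auto
    then show "{b \<otimes> \<one>, b \<otimes> x} = {b, x \<otimes> b}" using m_comm[OF assms(1)] by simp
  qed
  also have "\<dots> = B \<union> ((x <# B) - B)"
    by (auto simp: l_coset_def)
  finally have "B <#> {\<one>, x} = B \<union> ((x <# B) - B)" .
  moreover have "finite (x <# B)" using l_coset_closed[OF assms] by simp
  ultimately show ?thesis
    unfolding gain_def using assms by (metis card_Un_disjoint Diff_disjoint finite_Diff finite_sub)
qed

lemma card_set_mult_left_le:
  assumes "B \<subseteq> carrier G" "C \<subseteq> carrier G" "\<one> \<in> C"
  shows "card B \<le> card (B <#> C)"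
proof (rule card_mono)
  show "finite (B <#> C)" using set_mult_closed assms by auto
  show "B \<subseteq> B <#> C"
  proof
    fix b assume "b \<in> B"
    then show "b \<in> B <#> C" using set_mult_mem[of b B \<one> C] assms by auto
  qed
qed

text \<open>Pigeonhole: for each \<open>g\<close>, the sets \<open>A\<close> and
  \<open>g \<otimes> inv b\<close> for \<open>b\<close> in \<open>B\<close> are too large to be
  disjoint.\<close>

lemma set_mult_eq_carrier:
  assumes "A \<subseteq> carrier G" "B \<subseteq> carrier G" "order G < card A + card B"
  shows "A <#> B = carrier G"
proof
  show "A <#> B \<subseteq> carrier G" using set_mult_closed assms by blast
  show "carrier G \<subseteq> A <#> B"
  proof
    fix g assume g: "g \<in> carrier G"
    let ?C = "(\<lambda>b. g \<otimes> inv b) ` B"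
    have "inj_on (\<lambda>b. g \<otimes> inv b) B"
      using assms g by (auto simp: inj_on_def subset_iff)
    then have c: "card ?C = card B" by (rule card_image)
    have C: "?C \<subseteq> carrier G" using assms g by auto
    have "A \<inter> ?C \<noteq> {}"
    proof
      assume "A \<inter> ?C = {}"
      then have "card (A \<union> ?C) = card A + card B"
        using c assms by (subst card_Un_disjoint) auto
      moreover have "card (A \<union> ?C) \<le> order G"
        unfolding order_def using C assms by (intro card_mono) auto
      ultimately show False using assms by simp
    qed
    then obtain b where b: "b \<in> B" "g \<otimes> inv b \<in> A" by auto
    moreover have "(g \<otimes> inv b) \<otimes> b = g" using b(1) g assms by (auto simp: m_assoc subset_iff)
    ultimately show "g \<in> A <#> B" using set_mult_mem[OF b(2) b(1)] by simp
  qed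
qed

section \<open>Quadratic growth of subset sums\<close>

text \<open>Greedy choice: an element of \<open>D\<close> with large gain is absorbed into
  \<open>B\<close>, then the rest of \<open>D\<close> is treated alike. With d elements left a step
  gains at least \<open>K * d / (2 * (K + 1))\<close>; summing over d yields the quadratic
  term.\<close>

lemma card_set_mult_subset_sums_ge:
  assumes "D \<subseteq> gens" "\<one> \<notin> D" "B \<subseteq> carrier G" "(K + 1) * card D \<le> 2 * card B"
    "(K + 1) * card D + 2 * card (B <#> subset_sums G D) \<le> 2 * order G"
  shows "4 * (K + 1) * card B + K * (card D)\<^sup>2 \<le> 4 * (K + 1) * card (B <#> subset_sums G D)"
  using assms
proof (induction "card D" arbitrary: B D)
  case 0
  have "finite D" using 0 gens_subset by auto
  then have "D = {}" using 0 by simp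
  then show ?case
    using card_set_mult_left_le[of B "{\<one>}"] 0 by auto
next
  case (Suc d)
  have Dc: "D \<subseteq> carrier G" and finD: "finite D" using Suc.prems gens_subset by auto
  \<comment> \<open>The upper size hypothesis concerns only the final product set; every
    intermediate set is at most as large and inherits it.\<close>
  have "card B \<le> card (B <#> subset_sums G D)"
    using Suc.prems Dc subset_sums_closed one_in_subset_sums by (intro card_set_mult_left_le) auto
  then have "\<exists>x\<in>D. K * card D \<le> 2 * (K + 1) * gain B x"
    using Suc.prems Suc.hyps(2) by (intro exists_large_gain) auto
  then obtain x where x: "x \<in> D" "K * card D \<le> 2 * (K + 1) * gain B x" by blast
  have xc: "x \<in> carrier G" using x Dc by auto
  define D' where "D' = D - {x}"
  define B' where "B' = B <#> {\<one>, x}"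
  have d: "card D' = d" using x finD Suc.hyps(2) by (simp add: D'_def)
  have B'c: "B' \<subseteq> carrier G" unfolding B'_def using set_mult_closed Suc.prems xc by auto
  have cB': "card B' = card B + gain B x"
    unfolding B'_def using card_set_mult_pair xc Suc.prems by auto
  have "D = {x} \<union> D'" using x by (auto simp: D'_def)
  then have "subset_sums G D = {\<one>, x} <#> subset_sums G D'"
    using subset_sums_Un[of "{x}" D'] subset_sums_singleton[OF xc] Dc xc by (auto simp: D'_def)
  then have eq: "B <#> subset_sums G D = B' <#> subset_sums G D'"
    unfolding B'_def using set_mult_assoc Suc.prems xc subset_sums_closed Dc
    by (metis (no_types, lifting) D'_def Diff_subset empty_subsetI insert_subset one_closed subset_trans)
  have le: "(K + 1) * card D' \<le> (K + 1) * card D" using d Suc.hyps(2) by (intro mult_left_mono) auto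
  have "4 * (K + 1) * card B' + K * (card D')\<^sup>2 \<le> 4 * (K + 1) * card (B' <#> subset_sums G D')"
  proof (rule Suc.hyps(1))
    show "d = card D'" using d by simp
    show "D' \<subseteq> gens" "\<one> \<notin> D'" using Suc.prems by (auto simp: D'_def)
    show "(K + 1) * card D' \<le> 2 * card B'" using le Suc.prems cB' by linarith
    show "(K + 1) * card D' + 2 * card (B' <#> subset_sums G D') \<le> 2 * order G"
      using le Suc.prems eq by simp
  qed fact
  \<comment> \<open>With \<open>card D = d + 1\<close>, this is (d + 1)^2 \<le> d^2 + 2 (d + 1),
    which telescopes the linear gains into a square.\<close>
  moreover have "K * (card D)\<^sup>2 \<le> K * (card D')\<^sup>2 + 2 * (K * card D)"
    using d Suc.hyps(2)[symmetric] by (simp add: power2_eq_square algebra_simps)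
  ultimately show ?case using x(2) unfolding eq[symmetric] cB' by (simp add: algebra_simps)
qed

lemma one_in_gens_imp_trivial:
  assumes "\<one> \<in> gens"
  shows "carrier G = {\<one>}"
  using gens_closed_imp_carrier[OF assms, of "{\<one>}"] by (auto simp: l_coset_def)

text \<open>A crude bound from precision \<open>K = 1\<close>: the sums of one half of
  \<open>A\<close> include that half, which is just large enough as a starting set for the other
  half.\<close>

lemma card_subset_sums_ge:
  assumes "A \<subseteq> gens" "\<one> \<notin> A" "card A = 2 * m" "2 * m + card (subset_sums G A) \<le> order G"
  shows "m\<^sup>2 \<le> 8 * card (subset_sums G A)"
proof -
  have Ac: "A \<subseteq> carrier G" using assms gens_subset by auto
  obtain C where C: "C \<subseteq> A" "card C = m" "finite C"
    using obtain_subset_with_card_n[of m A] assms by auto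
  have cD: "card (A - C) = m" using C assms by (simp add: card_Diff_subset)
  have "C \<union> (A - C) = A" using C by auto
  then have eq: "subset_sums G A = subset_sums G C <#> subset_sums G (A - C)"
    using subset_sums_Un[of C "A - C"] C Ac by auto
  have Cc: "subset_sums G C \<subseteq> carrier G" using C Ac subset_sums_closed by auto
  have m: "m \<le> card (subset_sums G C)"
    using card_mono[OF finite_sub[OF Cc] subset_subset_sums] C Ac by auto
  have "4 * (1 + 1) * card (subset_sums G C) + 1 * (card (A - C))\<^sup>2 \<le>
      4 * (1 + 1) * card (subset_sums G C <#> subset_sums G (A - C))"
    using assms m cD eq Cc by (intro card_set_mult_subset_sums_ge) auto
  then show ?thesis using cD eq by simp
qed

text \<open>The two parts set aside have \<open>2 * m\<close> elements each, hence at least m^2 / 8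
  subset sums by the crude bound. The last hypothesis makes this enough for precision
  \<open>K\<close> with \<open>d\<close> remaining elements, at both ends of the size range.\<close>

lemma incomplete_bound:
  assumes "A \<subseteq> gens" "subset_sums G A \<noteq> carrier G" "4 * m + d \<le> card A"
    "4 * (K + 1) * d \<le> m\<^sup>2"
  shows "K * d\<^sup>2 \<le> 4 * (K + 1) * order G"
proof -
  \<comment> \<open>A group generated by \<open>\<one>\<close> is trivial, and there the empty sum
    alone is everything.\<close>
  have "\<one> \<notin> A"
  proof
    assume "\<one> \<in> A"
    then have "carrier G = {\<one>}" using one_in_gens_imp_trivial assms(1) by auto
    moreover have "subset_sums G A \<subseteq> carrier G"
      using assms(1) gens_subset subset_sums_closed by blast
    ultimately show False using assms(2) one_in_subset_sums[of A] by auto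
  qed
  have Ac: "A \<subseteq> carrier G" and finA: "finite A" using assms gens_subset by auto
  obtain A1 where A1: "A1 \<subseteq> A" "card A1 = 2 * m" "finite A1"
    using obtain_subset_with_card_n[of "2 * m" A] assms(3) by auto
  have "2 * m \<le> card (A - A1)" using A1 assms(3) by (simp add: card_Diff_subset)
  then obtain A2 where A2: "A2 \<subseteq> A - A1" "card A2 = 2 * m" "finite A2"
    using obtain_subset_with_card_n by metis
  have "d \<le> card (A - A1 - A2)" using A1 A2 assms(3) by (simp add: card_Diff_subset)
  then obtain D where D: "D \<subseteq> A - A1 - A2" "card D = d" "finite D"
    using obtain_subset_with_card_n by metis
  have sub: "A1 \<subseteq> carrier G" "A2 \<subseteq> carrier G" "D \<subseteq> carrier G"
    using A1 A2 D Ac by auto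
  let ?S = "subset_sums G"
  note cl = sub[THEN subset_sums_closed]
  have cl1: "?S A1 <#> ?S D \<subseteq> carrier G" using set_mult_closed cl by blast
  have "?S ((A1 \<union> D) \<union> A2) = (?S A1 <#> ?S D) <#> ?S A2"
  proof -
    have "?S (A1 \<union> D) = ?S A1 <#> ?S D" using D sub by (intro subset_sums_Un) auto
    moreover have "?S ((A1 \<union> D) \<union> A2) = ?S (A1 \<union> D) <#> ?S A2"
      using A2 D sub by (intro subset_sums_Un) auto
    ultimately show ?thesis by simp
  qed
  moreover have "?S ((A1 \<union> D) \<union> A2) \<subseteq> ?S A"
    using A1 A2 D by (intro subset_sums_mono) auto
  ultimately have "(?S A1 <#> ?S D) <#> ?S A2 \<noteq> carrier G"
    using assms(2) subset_sums_closed[OF Ac] by auto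
  then have le: "card (?S A1 <#> ?S D) + card (?S A2) \<le> order G"
    using set_mult_eq_carrier[OF cl1 cl(2)] by linarith
  have A1le: "card (?S A1) \<le> card (?S A1 <#> ?S D)"
    using cl one_in_subset_sums by (intro card_set_mult_left_le) auto
  have m1: "2 * m \<le> card (?S A1)" "2 * m \<le> card (?S A2)"
    using card_mono[OF finite_sub[OF cl(1)] subset_subset_sums] card_mono[OF finite_sub[OF cl(2)] subset_subset_sums]
      A1 A2 sub by auto
  \<comment> \<open>The room that the crude bound requires comes from the other part, which has at
    least \<open>2 * m\<close> sums, while \<open>le\<close> caps the total by the order.\<close>
  have L1: "m\<^sup>2 \<le> 8 * card (?S A1)"
    using A1 assms \<open>\<one> \<notin> A\<close> m1 le A1le by (intro card_subset_sums_ge) auto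
  have L2: "m\<^sup>2 \<le> 8 * card (?S A2)"
    using A2 assms \<open>\<one> \<notin> A\<close> m1 le A1le by (intro card_subset_sums_ge) auto
  have "4 * (K + 1) * card (?S A1) + K * (card D)\<^sup>2 \<le> 4 * (K + 1) * card (?S A1 <#> ?S D)"
  proof (rule card_set_mult_subset_sums_ge)
    have "4 * ((K + 1) * card D) \<le> m\<^sup>2" using D assms(4) by (simp only: mult.assoc)
    then show "(K + 1) * card D \<le> 2 * card (?S A1)"
      "(K + 1) * card D + 2 * card (?S A1 <#> ?S D) \<le> 2 * order G"
      using L1 L2 le by linarith+
  qed (use D assms(1) \<open>\<one> \<notin> A\<close> cl in auto)
  then have "K * d\<^sup>2 \<le> 4 * (K + 1) * card (?S A1 <#> ?S D)" using D by simp
  also have "\<dots> \<le> 4 * (K + 1) * order G" using le by (intro mult_left_mono) auto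
  finally show ?thesis .
qed

end

section \<open>Residues modulo n and the choice of parameters\<close>

text \<open>If \<open>c\<close> inverts \<open>a\<close> modulo \<open>n\<close>, then
  \<open>z\<close> is the \<open>z * c\<close>-fold multiple of \<open>a\<close>.\<close>

lemma coprime_residues_subset_gens:
  assumes "n > 0"
  shows "coprime_residues n \<subseteq> finite_comm_group.gens (integer_mod_group n)"
proof
  interpret finite_comm_group "integer_mod_group n"
    by (intro finite_comm_group.intro abelian_integer_mod_group finite_comm_group_axioms.intro)
      (use assms in \<open>simp add: carrier_integer_mod_group\<close>)
  fix a assume a: "a \<in> coprime_residues n"
  then have ac: "a \<in> carrier (integer_mod_group n)" "coprime a (int n)"
    by (auto simp: coprime_residues_def)
  have "z \<in> generate (integer_mod_group n) {a}" if z: "z \<in> carrier (integer_mod_group n)" for z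
  proof -
    obtain c where "[a * c = 1] (mod int n)"
      using cong_solve_coprime_int[OF ac(2)] by auto
    then have "[z * (a * c) = z * 1] (mod int n)" by (intro cong_mult) auto
    then have "(z * c * a) mod int n = z"
      using z assms by (simp add: Cong.cong_def carrier_integer_mod_group ac_simps)
    then have "z = a [^]\<^bsub>integer_mod_group n\<^esub> (z * c)"
      by (simp add: int_pow_integer_mod_group)
    then show ?thesis using generate_pow[OF ac(1)] by blast
  qed
  then show "a \<in> gens" using ac generate_incl[of "{a}"] by (auto simp: gens_def)
qed

lemma integer_mod_group_incomplete_bound:
  assumes "n > 0" "A \<subseteq> coprime_residues n"
    "subset_sums (integer_mod_group n) A \<noteq> carrier (integer_mod_group n)"
    "4 * m + d \<le> card A" "4 * (K + 1) * d \<le> m\<^sup>2"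
  shows "K * d\<^sup>2 \<le> 4 * (K + 1) * n"
proof -
  interpret finite_comm_group "integer_mod_group n"
    by (intro finite_comm_group.intro abelian_integer_mod_group finite_comm_group_axioms.intro)
      (use assms in \<open>simp add: carrier_integer_mod_group\<close>)
  have "A \<subseteq> gens" using coprime_residues_subset_gens assms by blast
  moreover have "order (integer_mod_group n) = n"
    using assms by (simp add: order_def carrier_integer_mod_group)
  ultimately show ?thesis using incomplete_bound assms by metis
qed

theorem theorem1p5:
  shows "\<exists>\<epsilon> :: nat \<Rightarrow> real. \<epsilon> \<longlonglongrightarrow> 0 \<and>
    (\<forall>n > 0. \<forall>A \<subseteq> coprime_residues n.
      subset_sums (integer_mod_group n) A \<noteq> carrier (integer_mod_group n) \<longrightarrow>
      real (card A) \<le> (2 + \<epsilon> n) * sqrt (real n))"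
proof -
  \<comment> \<open>With \<open>K\<close> of order \<open>n\<^sup>1\<^sup>/\<^sup>6\<close>, the relative error \<open>1/K\<close> balances the loss \<open>m / sqrt n\<close> of the
    parts set aside, as \<open>m\<^sup>2\<close> must be of order \<open>K * sqrt n\<close>.\<close>
  define s where "s n = sqrt (4 * (real n powr (1/6) + 2) * (3 * sqrt (real n) + 1))" for n :: nat
  define \<epsilon> where "\<epsilon> n = 4 * (s n + 1) / sqrt (real n) + 2 / real n powr (1/6)" for n :: nat
  \<comment> \<open>\<open>s n\<close> grows like n^(1/3), so both summands of
    \<open>\<epsilon> n\<close> are of order n^(-1/6).\<close>
  have "\<epsilon> \<longlonglongrightarrow> 0" unfolding \<epsilon>_def s_def by real_asymp
  moreover have "real (card A) \<le> (2 + \<epsilon> n) * sqrt (real n)"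
    if n: "n > 0" and A: "A \<subseteq> coprime_residues n"
      and incomplete: "subset_sums (integer_mod_group n) A \<noteq> carrier (integer_mod_group n)" for n A
  proof -
    define t where "t = real n powr (1/6)"
    define q where "q = sqrt (real n)"
    have t: "t > 0" and q: "q > 0" "q\<^sup>2 = real n" using n by (auto simp: t_def q_def)
    define K where "K = nat \<lfloor>t\<rfloor> + 1"
    \<comment> \<open>The square of \<open>s n\<close> is the value of
      \<open>4 * (K + 1) * d\<close> at the upper bounds \<open>t + 1\<close> for \<open>K\<close>
      and \<open>3 * q + 1\<close> for \<open>d\<close>.\<close>
    define m where "m = nat \<lceil>s n\<rceil>"
    \<comment> \<open>The cap keeps \<open>d\<close> of order sqrt n before anything is known about
      \<open>card A\<close>, so that \<open>m\<close> can be fixed independently of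
      \<open>A\<close>.\<close>
    define d where "d = min (card A - 4 * m) (nat \<lfloor>3 * q\<rfloor> + 1)"
    have "real K = of_int \<lfloor>t\<rfloor> + 1" using t by (simp add: K_def)
    then have K: "t \<le> real K" "real K \<le> t + 1" by linarith+
    have s0: "s n \<ge> 0" using t q by (simp add: s_def t_def[symmetric] q_def[symmetric])
    then have "real m = of_int \<lceil>s n\<rceil>" by (simp add: m_def)
    then have m: "s n \<le> real m" "real m \<le> s n + 1" by linarith+
    have d: "real d \<le> 3 * q + 1"
    proof -
      have "real d \<le> real (nat \<lfloor>3 * q\<rfloor> + 1)" unfolding d_def by (rule of_nat_mono) simp
      also have "\<dots> \<le> 3 * q + 1" using q by simp
      finally show ?thesis .
    qed
    have "real (4 * (K + 1) * d) = 4 * (real K + 1) * real d" by simp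
    also have "\<dots> \<le> 4 * (t + 2) * (3 * q + 1)" using K d q t by (intro mult_mono) auto
    also have "\<dots> = (s n)\<^sup>2" using t q by (simp add: s_def t_def[symmetric] q_def[symmetric])
    also have "\<dots> \<le> (real m)\<^sup>2" using m s0 by (intro power_mono) auto
    finally have dm: "4 * (K + 1) * d \<le> m\<^sup>2" by (metis of_nat_le_iff of_nat_power)
    have dq: "real K * (real d)\<^sup>2 \<le> 4 * (real K + 1) * q\<^sup>2" if "4 * m + d \<le> card A"
    proof -
      have "K * d\<^sup>2 \<le> 4 * (K + 1) * n"
        using integer_mod_group_incomplete_bound[OF n A incomplete that dm] .
      then have "real (K * d\<^sup>2) \<le> real (4 * (K + 1) * n)" by (rule of_nat_mono)
      moreover have "real (4 * (K + 1) * n) = 4 * (real K + 1) * real n" by simp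
      ultimately show ?thesis
        unfolding q(2) by (simp only: of_nat_mult of_nat_power)
    qed
    have nonneg: "0 \<le> 2 * q * (1 + 1 / t)"
      using q(1) t by (intro mult_nonneg_nonneg add_nonneg_nonneg) simp_all
    have "real (card A) \<le> 4 * real m + 2 * q * (1 + 1 / t)"
    proof (cases "4 * m \<le> card A")
      case True
      then have le: "4 * m + d \<le> card A" by (auto simp: d_def)
      have Kpos: "real K \<ge> 1" by (simp add: K_def)
      \<comment> \<open>The cap is not attained: as \<open>K \<ge> 1\<close>, the factor
        \<open>4 * (K + 1)\<close> is at most \<open>8 * K\<close>, below the \<open>9 * K\<close>
        that \<open>d > 3 * q\<close> would force. Hence \<open>d\<close> is all of
        \<open>card A - 4 * m\<close>.\<close>
      have "\<not> 3 * q < real d"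
      proof
        assume "3 * q < real d"
        then have "(3 * q)\<^sup>2 < (real d)\<^sup>2" using q by (intro power_strict_mono) auto
        then have "real K * (9 * q\<^sup>2) < real K * (real d)\<^sup>2" using Kpos by (simp add: power_mult_distrib)
        also have "\<dots> \<le> (4 * (real K + 1)) * q\<^sup>2" using dq[OF le] by simp
        also have "\<dots> \<le> (8 * real K) * q\<^sup>2" using Kpos by (intro mult_right_mono) auto
        also have "\<dots> \<le> real K * (9 * q\<^sup>2)" by simp
        finally show False by simp
      qed
      moreover have "3 * q < real (nat \<lfloor>3 * q\<rfloor> + 1)" by linarith
      ultimately have "d \<noteq> nat \<lfloor>3 * q\<rfloor> + 1" by metis
      then have "d = card A - 4 * m" unfolding d_def by linarith
      then have d_eq: "card A = 4 * m + d" using True by linarith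
      have "(real d)\<^sup>2 \<le> (4 * (real K + 1) * q\<^sup>2) / real K"
        using dq[OF le] Kpos by (simp add: pos_le_divide_eq mult.commute)
      also have "\<dots> = (2 * q)\<^sup>2 * ((real K + 1) / real K)" by (simp add: power_mult_distrib)
      also have "(real K + 1) / real K = 1 + 1 / real K" using Kpos by (simp add: add_divide_distrib)
      \<comment> \<open>Squaring the factor \<open>1 + 1 / t\<close> only weakens the bound and
        makes the right side a perfect square.\<close>
      also have "(2 * q)\<^sup>2 * (1 + 1 / real K) \<le> (2 * q)\<^sup>2 * (1 + 1 / t)\<^sup>2"
      proof (intro mult_left_mono)
        have "1 + 1 / real K \<le> 1 + 1 / t" using K t by (simp add: frac_le)
        also have "\<dots> \<le> (1 + 1 / t)\<^sup>2" using t by (intro self_le_power) auto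
        finally show "1 + 1 / real K \<le> (1 + 1 / t)\<^sup>2" .
      qed simp
      finally have "(real d)\<^sup>2 \<le> (2 * q * (1 + 1 / t))\<^sup>2" by (simp only: power_mult_distrib)
      then have "real d \<le> 2 * q * (1 + 1 / t)" using nonneg by (rule power2_le_imp_le)
      then show ?thesis using d_eq by simp
    next
      case False
      then show ?thesis using nonneg by linarith
    qed
    also have "\<dots> \<le> 4 * (s n + 1) + 2 * q * (1 + 1 / t)" using m by simp
    also have "\<dots> = (2 + \<epsilon> n) * q"
    proof -
      have "\<epsilon> n = 4 * (s n + 1) / q + 2 / t" by (simp add: \<epsilon>_def t_def q_def)
      then have "\<epsilon> n * q = 4 * (s n + 1) + 2 * q * (1 / t)" using q(1) by (simp add: distrib_right add_divide_distrib)
      then show ?thesis by (simp add: distrib_left distrib_right)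
    qed
    finally show ?thesis by (simp add: q_def)
  qed
  ultimately show ?thesis by blast
qed

end
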